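(* Let $\delta\ge2$ be an integer, $\alpha\in(0,\pi)$, and let $\mathbf{g}(u)=\left[g^{\ell}(u)\right]_{\ell=1}^{\delta}$, $u\in[0,\alpha]$, be the smooth parametric curve in $\mathbb{R}^{\delta}$ with coordinate functions $$g^{\ell}(u)=\sum_{p\in P_{\ell}}c_{p}^{\ell}\cos\left(pu+\psi_{p}^{\ell}\right)+\sum_{q\in Q_{\ell}}s_{q}^{\ell}\sin\left(qu+\varphi_{q}^{\ell}\right),$$ where $P_{\ell},Q_{\ell}\subset\mathbb{N}$ are finite and $c_{p}^{\ell},\psi_{p}^{\ell},s_{q}^{\ell},\varphi_{q}^{\ell}\in\mathbb{R}$. Let $n\ge1$ be an integer with $n\ge n_{\min}=\max\left\{z:z\in\bigcup_{\ell=1}^{\delta}(P_{\ell}\cup Q_{\ell})\right\}$. Then for every $r\in\mathbb{N}$ the $r$th order derivative of $\mathbf{g}$ can be written as $$\frac{\mathrm{d}^{r}}{\mathrm{d}u^{r}}\mathbf{g}(u)=\sum_{i=0}^{2n}\mathbf{d}_{i}(r)\,T_{2n,i}^{\alpha}(u),\quad\forall u\in[0,\alpha],$$ where the control points $\mathbf{d}_{i}(r)=\left[d_{i}^{\ell}(r)\right]_{\ell=1}^{\delta}$ are determined by the coordinates $$d_{i}^{\ell}(r)=\sum_{p\in P_{\ell}}c_{p}^{\ell}p^{r}\left(\mu_{p,i}^{n}\cos\left(\psi_{p}^{\ell}+\tfrac{r\pi}{2}\right)-\lambda_{p,i}^{n}\sin\left(\psi_{p}^{\ell}+\tfrac{r\pi}{2}\right)\right)+\sum_{q\in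 Q_{\ell}}s_{q}^{\ell}q^{r}\left(\lambda_{q,i}^{n}\cos\left(\varphi_{q}^{\ell}+\tfrac{r\pi}{2}\right)+\mu_{q,i}^{n}\sin\left(\varphi_{q}^{\ell}+\tfrac{r\pi}{2}\right)\right).$$
   Context: Here $\mathbb{N}=\{0,1,2,\ldots\}$ and $0^{0}=1$. For an integer $n\ge1$ and $\alpha\in(0,\pi)$ let $$T_{2n,i}^{\alpha}(u)=t_{2n,i}^{\alpha}\,\sin^{2n-i}\!\left(\tfrac{\alpha-u}{2}\right)\sin^{i}\!\left(\tfrac{u}{2}\right),\quad u\in[0,\alpha],\ i=0,1,\ldots,2n,$$ where $$t_{2n,i}^{\alpha}=\frac{1}{\sin^{2n}(\alpha/2)}\sum_{r=0}^{\lfloor i/2\rfloor}\binom{n}{i-r}\binom{i-r}{r}\left(2\cos(\alpha/2)\right)^{i-2r}.$$ The functions $\{T_{2n,i}^{\alpha}\}_{i=0}^{2n}$ form a basis (the normalized B-basis) of $\operatorname{span}\{\cos(ku),\sin(ku):u\in[0,\alpha]\}_{k=0}^{n}$. For $k\in\{0,1,\ldots,n\}$, $\{\lambda_{k,i}^{n}\}_{i=0}^{2n}$ and $\{\mu_{k,i}^{n}\}_{i=0}^{2n}$ denote the unique real numbers such that, for all $u\in[0,\alpha]$, $$\sin(ku)=\sum_{i=0}^{2n}\lambda_{k,i}^{n}T_{2n,i}^{\alpha}(u),\qquad \cos(ku)=\sum_{i=0}^{2n}\mu_{k,i}^{n}T_{2n,i}^{\alpha}(u).$$ *)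

theory Defs
  imports "HOL-Analysis.Analysis"
begin

definition t_coeff :: "nat \<Rightarrow> real \<Rightarrow> nat \<Rightarrow> real" where
  "t_coeff n \<alpha> i =
     1 / sin (\<alpha> / 2) ^ (2 * n) *
     (\<Sum>r = 0..i div 2. real (n choose (i - r)) * real ((i - r) choose r) *
        (2 * cos (\<alpha> / 2)) ^ (i - 2 * r))"

text \<open>Meant for \<open>i \<le> 2n\<close> only: beyond that the exponent \<open>2n - i\<close> is truncated at \<open>0\<close>.\<close>

definition T_basis :: "nat \<Rightarrow> real \<Rightarrow> nat \<Rightarrow> real \<Rightarrow> real" where
  "T_basis n \<alpha> i u =
     t_coeff n \<alpha> i * sin ((\<alpha> - u) / 2) ^ (2 * n - i) * sin (u / 2) ^ i"

text \<open>The unique coordinates on \<open>{0..\<alpha>}\<close> of a trigonometric polynomial \<open>f\<close> of order at most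
  \<open>n\<close>. They are indexed by all of \<open>nat\<close>, hence fixed to \<open>0\<close> beyond \<open>2n\<close>; otherwise the
  coordinate sequence would not be unique.\<close>

definition B_coords :: "nat \<Rightarrow> real \<Rightarrow> (real \<Rightarrow> real) \<Rightarrow> nat \<Rightarrow> real" where
  "B_coords n \<alpha> f =
     (THE b. (\<forall>i > 2 * n. b i = 0) \<and>
             (\<forall>u \<in> {0..\<alpha>}. f u = (\<Sum>i = 0..2 * n. b i * T_basis n \<alpha> i u)))"

definition lam :: "nat \<Rightarrow> real \<Rightarrow> nat \<Rightarrow> nat \<Rightarrow> real" where
  "lam n \<alpha> k = B_coords n \<alpha> (\<lambda>u. sin (real k * u))"

definition mu :: "nat \<Rightarrow> real \<Rightarrow> nat \<Rightarrow> nat \<Rightarrow> real" where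
  "mu n \<alpha> k = B_coords n \<alpha> (\<lambda>u. cos (real k * u))"

text \<open>Iterated derivative relative to \<open>S\<close>; on a compact interval the derivatives at the end
  points are one-sided, and values outside \<open>S\<close> are irrelevant. As with
  \<^const>\<open>vector_derivative\<close>, the value is meaningful only where the function is differentiable.\<close>

primrec nth_vector_derivative ::
    "real set \<Rightarrow> nat \<Rightarrow> (real \<Rightarrow> 'a::real_normed_vector) \<Rightarrow> real \<Rightarrow> 'a" where
  "nth_vector_derivative S 0 f = f"
| "nth_vector_derivative S (Suc r) f =
     (\<lambda>u. vector_derivative (nth_vector_derivative S r f) (at u within S))"

end

theory Submission imports Defs
begin

text \<open>The only substantial point is that \<^const>\<open>lam\<close> and \<^const>\<open>mu\<close>, which are defined as definite
  descriptions, really are coordinates of \<open>sin (k u)\<close> and \<open>cos (k u)\<close> for \<open>k \<le> n\<close>.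

  Existence. Put \<open>x = sin ((\<alpha> - u) / 2)\<close> and \<open>y = sin (u / 2)\<close>. Since \<open>sin (\<alpha> / 2) \<noteq> 0\<close>, the function
  \<open>cos (u / 2)\<close> is a linear combination of \<open>x\<close> and \<open>y\<close>, so multiplication by \<open>sin (u / 2)\<close> or
  \<open>cos (u / 2)\<close> sends homogeneous forms of degree \<open>m\<close> in \<open>x, y\<close> to forms of degree \<open>m + 1\<close>. Hence
  multiplication by \<open>sin u\<close>, \<open>cos u\<close> or \<open>1 = sin\<^sup>2 (u / 2) + cos\<^sup>2 (u / 2)\<close> raises the degree by \<open>2\<close>, and by
  induction \<open>sin (k u)\<close> and \<open>cos (k u)\<close> are forms of degree \<open>2n\<close> for all \<open>k \<le> n\<close>
  (\<open>sin_cos_multiple_binary_form\<close>). All \<^const>\<open>t_coeff\<close> of index at most \<open>2n\<close> are positive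
  (\<open>t_coeff_pos\<close>), so a form of degree \<open>2n\<close> is a combination of the \<^const>\<open>T_basis\<close> functions.

  Uniqueness. On \<open>[0, \<alpha>)\<close> a vanishing form may be divided by \<open>x ^ (2n)\<close>, which leaves a polynomial
  in \<open>y / x\<close>. As \<open>y / x\<close> is injective there, this polynomial has infinitely many roots and its
  coefficients vanish (\<open>T_basis_independent\<close>).

  Differentiating \<open>r\<close> times multiplies a wave of frequency \<open>p\<close> by \<open>p ^ r\<close> and advances its phase by
  \<open>r\<pi> / 2\<close>; the addition theorems then split it into \<open>sin (p u)\<close> and \<open>cos (p u)\<close>, whose coordinates are
  known.\<close>

section \<open>Homogeneous forms in two functions\<close>

text \<open>The function \<open>f\<close> is a homogeneous polynomial of degree \<open>m\<close> in the functions \<open>x\<close> and \<open>y\<close>.\<close>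

definition binary_form ::
    "('a \<Rightarrow> real) \<Rightarrow> ('a \<Rightarrow> real) \<Rightarrow> nat \<Rightarrow> ('a \<Rightarrow> real) \<Rightarrow> bool" where
  "binary_form x y m f \<longleftrightarrow> (\<exists>c. \<forall>u. f u = (\<Sum>i\<le>m. c i * x u ^ (m - i) * y u ^ i))"

lemma binary_form_const: "binary_form x y 0 (\<lambda>u. a)"
  unfolding binary_form_def by (rule exI[of _ "\<lambda>i. a"]) simp

lemma binary_form_add:
  assumes "binary_form x y m f" "binary_form x y m g"
  shows "binary_form x y m (\<lambda>u. f u + g u)"
proof -
  obtain c d where "\<forall>u. f u = (\<Sum>i\<le>m. c i * x u ^ (m - i) * y u ^ i)"
    and "\<forall>u. g u = (\<Sum>i\<le>m. d i * x u ^ (m - i) * y u ^ i)"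
    using assms unfolding binary_form_def by blast
  then show ?thesis
    unfolding binary_form_def
    by (intro exI[of _ "\<lambda>i. c i + d i"]) (simp add: algebra_simps sum.distrib)
qed

lemma binary_form_scale:
  assumes "binary_form x y m f"
  shows "binary_form x y m (\<lambda>u. a * f u)"
proof -
  obtain c where "\<forall>u. f u = (\<Sum>i\<le>m. c i * x u ^ (m - i) * y u ^ i)"
    using assms unfolding binary_form_def by blast
  then show ?thesis
    unfolding binary_form_def
    by (intro exI[of _ "\<lambda>i. a * c i"]) (simp add: sum_distrib_left mult.assoc)
qed

lemma binary_form_diff:
  assumes "binary_form x y m f" "binary_form x y m g"
  shows "binary_form x y m (\<lambda>u. f u - g u)"
  using binary_form_add[OF assms(1) binary_form_scale[OF assms(2), of "-1"]] by simp

lemma binary_form_mult_fst: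
  assumes "binary_form x y m f"
  shows "binary_form x y (Suc m) (\<lambda>u. x u * f u)"
proof -
  obtain c where c: "\<forall>u. f u = (\<Sum>i\<le>m. c i * x u ^ (m - i) * y u ^ i)"
    using assms unfolding binary_form_def by blast
  have "x u * f u = (\<Sum>i\<le>Suc m. (if i \<le> m then c i else 0) * x u ^ (Suc m - i) * y u ^ i)" for u
    using c by (auto simp: sum_distrib_left Suc_diff_le intro!: sum.cong)
  then show ?thesis
    unfolding binary_form_def by (intro exI[of _ "\<lambda>i. if i \<le> m then c i else 0"]) blast
qed

lemma binary_form_mult_snd:
  assumes "binary_form x y m f"
  shows "binary_form x y (Suc m) (\<lambda>u. y u * f u)"
proof -
  obtain c where c: "\<forall>u. f u = (\<Sum>i\<le>m. c i * x u ^ (m - i) * y u ^ i)"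
    using assms unfolding binary_form_def by blast
  have "y u * f u =
      (\<Sum>i\<le>Suc m. (if i = 0 then 0 else c (i - 1)) * x u ^ (Suc m - i) * y u ^ i)" for u
    unfolding sum.atMost_Suc_shift
    using c by (auto simp: sum_distrib_left intro!: sum.cong)
  then show ?thesis
    unfolding binary_form_def by (intro exI[of _ "\<lambda>i. if i = 0 then 0 else c (i - 1)"]) blast
qed

section \<open>Sines and cosines as homogeneous forms\<close>

context
  fixes \<alpha> :: real
  assumes \<alpha>: "sin (\<alpha> / 2) \<noteq> 0"
begin

text \<open>Forms of degree \<open>m\<close> in \<open>sin ((\<alpha> - u) / 2)\<close> and \<open>sin (u / 2)\<close>; the products occurring in the
  \<^const>\<open>T_basis\<close> functions of order \<open>n\<close> are the monomials of degree \<open>2 * n\<close>.\<close>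

abbreviation trig_form :: "nat \<Rightarrow> (real \<Rightarrow> real) \<Rightarrow> bool" where
  "trig_form \<equiv> binary_form (\<lambda>u. sin ((\<alpha> - u) / 2)) (\<lambda>u. sin (u / 2))"

lemma trig_form_mult_cos_half:
  assumes "trig_form m f"
  shows "trig_form (Suc m) (\<lambda>u. cos (u / 2) * f u)"
proof -
  have cos_half: "cos (u / 2) = 1 / sin (\<alpha> / 2) * sin ((\<alpha> - u) / 2)
      + cos (\<alpha> / 2) / sin (\<alpha> / 2) * sin (u / 2)" for u
  proof -
    have "sin (\<alpha> / 2) * cos (u / 2) = sin ((\<alpha> - u) / 2) + cos (\<alpha> / 2) * sin (u / 2)"
      by (simp add: diff_divide_distrib sin_diff)
    then have "cos (u / 2) = (sin ((\<alpha> - u) / 2) + cos (\<alpha> / 2) * sin (u / 2)) / sin (\<alpha> / 2)"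
      using \<alpha> nonzero_mult_div_cancel_left by metis
    then show ?thesis by (simp add: add_divide_distrib)
  qed
  have eq: "(\<lambda>u. cos (u / 2) * f u) = (\<lambda>u. 1 / sin (\<alpha> / 2) * (sin ((\<alpha> - u) / 2) * f u)
      + cos (\<alpha> / 2) / sin (\<alpha> / 2) * (sin (u / 2) * f u))"
  proof
    fix u
    show "cos (u / 2) * f u = 1 / sin (\<alpha> / 2) * (sin ((\<alpha> - u) / 2) * f u)
      + cos (\<alpha> / 2) / sin (\<alpha> / 2) * (sin (u / 2) * f u)"
      by (subst cos_half[of u]) (simp only: distrib_right mult.assoc)
  qed
  show ?thesis
    unfolding eq using assms
    by (intro binary_form_add binary_form_scale binary_form_mult_fst binary_form_mult_snd)
qed

text \<open>Degree elevation by \<open>2\<close>, through the factor \<open>1 = sin\<^sup>2 (u / 2) + cos\<^sup>2 (u / 2)\<close>.\<close>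

lemma trig_form_mult_one:
  assumes "trig_form m f"
  shows "trig_form (Suc (Suc m)) f"
proof -
  have eq: "f = (\<lambda>u. cos (u / 2) * (cos (u / 2) * f u) + sin (u / 2) * (sin (u / 2) * f u))"
  proof
    fix u
    have "f u = ((sin (u / 2))\<^sup>2 + (cos (u / 2))\<^sup>2) * f u"
      by simp
    then show "f u = cos (u / 2) * (cos (u / 2) * f u) + sin (u / 2) * (sin (u / 2) * f u)"
      by (simp only: power2_eq_square algebra_simps)
  qed
  show ?thesis
    by (subst eq) (intro binary_form_add trig_form_mult_cos_half binary_form_mult_snd assms)
qed

lemma trig_form_mult_cos:
  assumes "trig_form m f"
  shows "trig_form (Suc (Suc m)) (\<lambda>u. cos u * f u)"
proof -
  have "cos u * f u = cos (u / 2) * (cos (u / 2) * f u) - sin (u / 2) * (sin (u / 2) * f u)" for u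
  proof -
    have "cos u = cos (u / 2) * cos (u / 2) - sin (u / 2) * sin (u / 2)"
      using cos_add[of "u / 2" "u / 2"] by simp
    then show ?thesis by (simp only: left_diff_distrib mult.assoc)
  qed
  then show ?thesis
    using binary_form_diff[OF trig_form_mult_cos_half[OF trig_form_mult_cos_half[OF assms]]
        binary_form_mult_snd[OF binary_form_mult_snd[OF assms]]] by simp
qed

lemma trig_form_mult_sin:
  assumes "trig_form m f"
  shows "trig_form (Suc (Suc m)) (\<lambda>u. sin u * f u)"
proof -
  have "sin u * f u = 2 * (sin (u / 2) * (cos (u / 2) * f u))" for u
  proof -
    have "sin u = 2 * (sin (u / 2) * cos (u / 2))"
      using sin_add[of "u / 2" "u / 2"] by simp
    then show ?thesis by (simp only: mult.assoc)
  qed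
  then have eq: "(\<lambda>u. sin u * f u) = (\<lambda>u. 2 * (sin (u / 2) * (cos (u / 2) * f u)))"
    by blast
  show ?thesis
    unfolding eq by (intro binary_form_scale binary_form_mult_snd trig_form_mult_cos_half assms)
qed

lemma sin_cos_multiple_binary_form:
  "k \<le> n \<Longrightarrow> trig_form (2 * n) (\<lambda>u. sin (real k * u)) \<and> trig_form (2 * n) (\<lambda>u. cos (real k * u))"
proof (induction n arbitrary: k)
  case 0
  then show ?case by (simp add: binary_form_const)
next
  case (Suc n)
  show ?case
  proof (cases "k \<le> n")
    case True
    then show ?thesis using Suc.IH trig_form_mult_one by simp
  next
    case False
    then have k: "k = Suc n" using Suc.prems by simp
    have "real k * u = u + real n * u" for u
      by (simp add: k algebra_simps)
    then have "(\<lambda>u. sin (real k * u)) =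
        (\<lambda>u. sin u * cos (real n * u) + cos u * sin (real n * u))"
      and "(\<lambda>u. cos (real k * u)) =
        (\<lambda>u. cos u * cos (real n * u) - sin u * sin (real n * u))"
      by (simp_all add: sin_add cos_add)
    moreover have "trig_form (2 * n) (\<lambda>u. sin (real n * u))"
      and "trig_form (2 * n) (\<lambda>u. cos (real n * u))"
      using Suc.IH[of n] by auto
    ultimately show ?thesis
      by (simp add: trig_form_mult_sin trig_form_mult_cos binary_form_add binary_form_diff)
  qed
qed

end

section \<open>Coordinates with respect to the B-basis\<close>

lemma t_coeff_pos:
  assumes "0 < \<alpha>" "\<alpha> < pi" "i \<le> 2 * n"
  shows "0 < t_coeff n \<alpha> i"
proof -
  have s: "0 < sin (\<alpha> / 2)" and c: "0 < cos (\<alpha> / 2)"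
    using assms by (auto intro: sin_gt_zero cos_gt_zero)
  let ?f = "\<lambda>r. real (n choose (i - r)) * real ((i - r) choose r) * (2 * cos (\<alpha> / 2)) ^ (i - 2 * r)"
  \<comment> \<open>The summand with the largest index \<open>r\<close> is the one whose two binomials are certainly nonzero.\<close>
  have "0 < ?f (i div 2)"
    using c assms(3) by (intro mult_pos_pos) (auto simp: zero_less_binomial_iff)
  also have "?f (i div 2) \<le> (\<Sum>r = 0..i div 2. ?f r)"
    using c by (intro member_le_sum) auto
  finally show ?thesis
    unfolding t_coeff_def using s by simp
qed

lemma T_basis_independent:
  assumes \<alpha>: "0 < \<alpha>" "\<alpha> < pi"
    and eq: "\<And>u. u \<in> {0..\<alpha>} \<Longrightarrow> (\<Sum>i = 0..2 * n. b i * T_basis n \<alpha> i u) = 0"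
    and i: "i \<le> 2 * n"
  shows "b i = 0"
proof -
  define z where "z u = sin (u / 2) / sin ((\<alpha> - u) / 2)" for u
  have pos: "0 < sin ((\<alpha> - u) / 2)" if "u \<in> {0..<\<alpha>}" for u
    using that \<alpha> by (intro sin_gt_zero) auto
  have "inj_on z {0..<\<alpha>}"
  proof (rule linorder_inj_onI')
    fix u v assume uv: "u \<in> {0..<\<alpha>}" "v \<in> {0..<\<alpha>}" "u < v"
    have "sin (u / 2) < sin (v / 2)"
      using uv \<alpha> by (intro sin_monotone_2pi) auto
    moreover have "sin ((\<alpha> - v) / 2) < sin ((\<alpha> - u) / 2)"
      using uv \<alpha> by (intro sin_monotone_2pi) auto
    moreover have "0 \<le> sin (u / 2)"
      using uv \<alpha> by (intro sin_ge_zero) auto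
    ultimately have "z u < z v"
      unfolding z_def using pos[OF uv(1)] pos[OF uv(2)] by (intro frac_less) auto
    then show "z u \<noteq> z v" by simp
  qed
  moreover have "infinite {0..<\<alpha>}"
    using \<alpha> by (simp add: infinite_Ico)
  ultimately have inf: "infinite (z ` {0..<\<alpha>})"
    by (simp add: finite_image_iff)
  have root: "(\<Sum>i\<le>2 * n. (b i * t_coeff n \<alpha> i) * z u ^ i) = 0" if u: "u \<in> {0..<\<alpha>}" for u
  proof -
    let ?x = "sin ((\<alpha> - u) / 2)"
    have "?x ^ (2 * n) * (b i * t_coeff n \<alpha> i * z u ^ i) = b i * T_basis n \<alpha> i u"
      if "i \<le> 2 * n" for i
    proof -
      have "?x ^ (2 * n) = ?x ^ (2 * n - i) * ?x ^ i"
        using that by (simp flip: power_add)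
      then show ?thesis
        using pos[OF u] by (simp add: z_def T_basis_def power_divide)
    qed
    then have "?x ^ (2 * n) * (\<Sum>i\<le>2 * n. (b i * t_coeff n \<alpha> i) * z u ^ i)
        = (\<Sum>i = 0..2 * n. b i * T_basis n \<alpha> i u)"
      unfolding sum_distrib_left by (intro sum.cong) auto
    also have "\<dots> = 0"
      using u by (intro eq) auto
    finally show ?thesis using pos[OF u] by simp
  qed
  have "infinite {w. (\<Sum>i\<le>2 * n. (b i * t_coeff n \<alpha> i) * w ^ i) = 0}"
    using inf by (rule infinite_super[rotated]) (use root in auto)
  then have "b i * t_coeff n \<alpha> i = 0"
    using i unfolding polyfun_finite_roots by blast
  then show ?thesis
    using t_coeff_pos[OF \<alpha> i] by simp
qed

lemma B_coords_binary_form: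
  assumes \<alpha>: "0 < \<alpha>" "\<alpha> < pi"
    and f: "binary_form (\<lambda>u. sin ((\<alpha> - u) / 2)) (\<lambda>u. sin (u / 2)) (2 * n) f"
    and u: "u \<in> {0..\<alpha>}"
  shows "f u = (\<Sum>i = 0..2 * n. B_coords n \<alpha> f i * T_basis n \<alpha> i u)"
proof -
  let ?P = "\<lambda>b. (\<forall>i > 2 * n. b i = 0) \<and>
    (\<forall>u \<in> {0..\<alpha>}. f u = (\<Sum>i = 0..2 * n. b i * T_basis n \<alpha> i u))"
  obtain c where
    c: "\<And>u. f u = (\<Sum>i\<le>2 * n. c i * sin ((\<alpha> - u) / 2) ^ (2 * n - i) * sin (u / 2) ^ i)"
    using f unfolding binary_form_def by blast
  define b where "b i = (if i \<le> 2 * n then c i / t_coeff n \<alpha> i else 0)" for i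
  have "f u = (\<Sum>i = 0..2 * n. b i * T_basis n \<alpha> i u)" for u
    unfolding c
  proof (intro sum.cong)
    fix i assume "i \<in> {0..2 * n}"
    then have "i \<le> 2 * n" "t_coeff n \<alpha> i \<noteq> 0"
      using t_coeff_pos[OF \<alpha>, of i n] by auto
    then show "c i * sin ((\<alpha> - u) / 2) ^ (2 * n - i) * sin (u / 2) ^ i = b i * T_basis n \<alpha> i u"
      by (simp add: b_def T_basis_def)
  qed auto
  then have b: "?P b"
    by (auto simp: b_def)
  have "b' = b" if b': "?P b'" for b'
  proof
    fix i
    have "(\<Sum>i = 0..2 * n. (b' i - b i) * T_basis n \<alpha> i u) = 0" if "u \<in> {0..\<alpha>}" for u
    proof -
      have "(\<Sum>i = 0..2 * n. b' i * T_basis n \<alpha> i u) = (\<Sum>i = 0..2 * n. b i * T_basis n \<alpha> i u)"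
        using b b' that by metis
      then show ?thesis
        by (simp add: left_diff_distrib sum_subtractf)
    qed
    then have "b' i - b i = 0" if "i \<le> 2 * n"
      using T_basis_independent[OF \<alpha>, where b = "\<lambda>i. b' i - b i"] that by blast
    then show "b' i = b i"
      using b b' by (cases "i \<le> 2 * n") auto
  qed
  then have "?P (B_coords n \<alpha> f)"
    unfolding B_coords_def using b by (rule theI[where P = ?P, rotated])
  then show ?thesis
    using u by blast
qed

lemma
  assumes "0 < \<alpha>" "\<alpha> < pi" "k \<le> n" "u \<in> {0..\<alpha>}"
  shows sin_eq_sum_lam: "sin (real k * u) = (\<Sum>i = 0..2 * n. lam n \<alpha> k i * T_basis n \<alpha> i u)"
    and cos_eq_sum_mu: "cos (real k * u) = (\<Sum>i = 0..2 * n. mu n \<alpha> k i * T_basis n \<alpha> i u)"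
proof -
  have "sin (\<alpha> / 2) \<noteq> 0"
    using assms sin_gt_zero[of "\<alpha> / 2"] by simp
  from sin_cos_multiple_binary_form[OF this \<open>k \<le> n\<close>]
  show "sin (real k * u) = (\<Sum>i = 0..2 * n. lam n \<alpha> k i * T_basis n \<alpha> i u)"
    and "cos (real k * u) = (\<Sum>i = 0..2 * n. mu n \<alpha> k i * T_basis n \<alpha> i u)"
    unfolding lam_def mu_def
    using B_coords_binary_form[OF assms(1,2) _ assms(4)] by blast+
qed

lemma
  assumes "0 < \<alpha>" "\<alpha> < pi" "k \<le> n" "u \<in> {0..\<alpha>}"
  shows sin_shift_eq_sum: "sin (real k * u + \<theta>) =
      (\<Sum>i = 0..2 * n. (lam n \<alpha> k i * cos \<theta> + mu n \<alpha> k i * sin \<theta>) * T_basis n \<alpha> i u)"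
    and cos_shift_eq_sum: "cos (real k * u + \<theta>) =
      (\<Sum>i = 0..2 * n. (mu n \<alpha> k i * cos \<theta> - lam n \<alpha> k i * sin \<theta>) * T_basis n \<alpha> i u)"
  unfolding sin_add cos_add sin_eq_sum_lam[OF assms] cos_eq_sum_mu[OF assms]
    sum_distrib_right distrib_right left_diff_distrib sum.distrib sum_subtractf
  by (simp_all only: mult_ac)

section \<open>Iterated derivatives\<close>

lemma has_vector_derivative_cart:
  fixes f :: "real \<Rightarrow> real ^ 'd"
  assumes "\<And>l. ((\<lambda>u. f u $ l) has_vector_derivative f' $ l) (at u within S)"
  shows "(f has_vector_derivative f') (at u within S)"
  using assms unfolding has_vector_derivative_def
  by (subst has_derivative_componentwise_within) (auto simp: Basis_vec_def inner_axis)

text \<open>A sequence of functions each of which is the derivative of the preceding one on \<open>[a, b]\<close>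
  computes the iterated derivatives relative to \<open>[a, b]\<close>.\<close>

lemma nth_vector_derivative_eq:
  fixes G :: "nat \<Rightarrow> real \<Rightarrow> 'a::euclidean_space"
  assumes "a < b" "u \<in> {a..b}"
    and "\<And>u. u \<in> {a..b} \<Longrightarrow> g u = G 0 u"
    and deriv: "\<And>r u. u \<in> {a..b} \<Longrightarrow> (G r has_vector_derivative G (Suc r) u) (at u within {a..b})"
  shows "nth_vector_derivative {a..b} r g u = G r u"
  using \<open>u \<in> {a..b}\<close>
proof (induction r arbitrary: u)
  case 0
  then show ?case using assms(3) by simp
next
  case (Suc r)
  have "(nth_vector_derivative {a..b} r g has_vector_derivative G (Suc r) u) (at u within {a..b})"
    using Suc.prems Suc.IH deriv[OF Suc.prems] by (rule has_vector_derivative_transform)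
  then show ?case
    using \<open>a < b\<close> Suc.prems by (simp add: vector_derivative_within_closed_interval)
qed

text \<open>Each differentiation contributes a factor \<open>k\<close> and advances the phase by \<open>\<pi> / 2\<close>.\<close>

lemma
  shows has_derivative_shifted_cos: "((\<lambda>u. a * k ^ r * cos (k * u + (\<theta> + real r * pi / 2)))
      has_real_derivative a * k ^ Suc r * cos (k * u + (\<theta> + real (Suc r) * pi / 2))) (at u within S)"
    and has_derivative_shifted_sin: "((\<lambda>u. a * k ^ r * sin (k * u + (\<theta> + real r * pi / 2)))
      has_real_derivative a * k ^ Suc r * sin (k * u + (\<theta> + real (Suc r) * pi / 2))) (at u within S)"
proof -
  have shift: "k * u + (\<theta> + real (Suc r) * pi / 2) = k * u + (\<theta> + real r * pi / 2) + pi / 2"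
    by (simp add: field_simps)
  show "((\<lambda>u. a * k ^ r * cos (k * u + (\<theta> + real r * pi / 2)))
      has_real_derivative a * k ^ Suc r * cos (k * u + (\<theta> + real (Suc r) * pi / 2))) (at u within S)"
    unfolding shift cos_add[of _ "pi / 2"]
    by (rule derivative_eq_intros refl | simp)+
  show "((\<lambda>u. a * k ^ r * sin (k * u + (\<theta> + real r * pi / 2)))
      has_real_derivative a * k ^ Suc r * sin (k * u + (\<theta> + real (Suc r) * pi / 2))) (at u within S)"
    unfolding shift sin_add[of _ "pi / 2"]
    by (rule derivative_eq_intros refl | simp)+
qed

section \<open>Control points of the derivatives\<close>

theorem theorem5p1:
  fixes \<alpha> :: real
    and g :: "real \<Rightarrow> real ^ 'd"
    and P Q :: "'d \<Rightarrow> nat set"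
    and c \<psi> s \<phi> :: "'d \<Rightarrow> nat \<Rightarrow> real"
    and n :: nat
    and d :: "nat \<Rightarrow> nat \<Rightarrow> real ^ 'd"
  assumes "CARD('d) \<ge> 2"
    and "0 < \<alpha>" and "\<alpha> < pi"
    and "\<And>l. finite (P l)" and "\<And>l. finite (Q l)"
    and g: "\<And>u l. u \<in> {0..\<alpha>} \<Longrightarrow>
        g u $ l = (\<Sum>p\<in>P l. c l p * cos (real p * u + \<psi> l p)) +
                  (\<Sum>q\<in>Q l. s l q * sin (real q * u + \<phi> l q))"
    and "n \<ge> 1"
    and "n \<ge> Max (\<Union>l. P l \<union> Q l)"
    and d: "\<And>r i l. i \<le> 2 * n \<Longrightarrow>
        d r i $ l =
          (\<Sum>p\<in>P l. c l p * real p ^ r *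
             (mu n \<alpha> p i * cos (\<psi> l p + real r * pi / 2) -
              lam n \<alpha> p i * sin (\<psi> l p + real r * pi / 2))) +
          (\<Sum>q\<in>Q l. s l q * real q ^ r *
             (lam n \<alpha> q i * cos (\<phi> l q + real r * pi / 2) +
              mu n \<alpha> q i * sin (\<phi> l q + real r * pi / 2)))"
  shows "\<forall>r. nth_vector_derivative {0..\<alpha>} r g differentiable_on {0..\<alpha>} \<and>
           (\<forall>u\<in>{0..\<alpha>}. nth_vector_derivative {0..\<alpha>} r g u =
              (\<Sum>i = 0..2 * n. T_basis n \<alpha> i u *\<^sub>R d r i))"
proof -
  \<comment> \<open>The closed form of the derivative of order \<open>r\<close>.\<close>
  define G :: "nat \<Rightarrow> real \<Rightarrow> real ^ 'd" where
    "G r u = (\<chi> l. (\<Sum>p\<in>P l. c l p * real p ^ r * cos (real p * u + (\<psi> l p + real r * pi / 2))) +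
                   (\<Sum>q\<in>Q l. s l q * real q ^ r * sin (real q * u + (\<phi> l q + real r * pi / 2))))"
    for r u
  have deriv: "(G r has_vector_derivative G (Suc r) u) (at u within {0..\<alpha>})" for r u
  proof (rule has_vector_derivative_cart)
    fix l
    show "((\<lambda>u. G r u $ l) has_vector_derivative G (Suc r) u $ l) (at u within {0..\<alpha>})"
      unfolding G_def vec_lambda_beta has_real_derivative_iff_has_vector_derivative[symmetric]
      by (intro DERIV_add DERIV_sum has_derivative_shifted_cos has_derivative_shifted_sin)
  qed
  have G0: "g u = G 0 u" if "u \<in> {0..\<alpha>}" for u
    using g[OF that] by (simp add: vec_eq_iff G_def)
  have nth: "nth_vector_derivative {0..\<alpha>} r g u = G r u" if "u \<in> {0..\<alpha>}" for r u
    using \<open>0 < \<alpha>\<close> that G0 deriv by (rule nth_vector_derivative_eq)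
  have bound: "k \<le> n" if "k \<in> P l \<union> Q l" for k l
  proof -
    have "finite (\<Union>l. P l \<union> Q l)"
      using assms(4,5) by simp
    then have "k \<le> Max (\<Union>l. P l \<union> Q l)"
      using that by (intro Max_ge) auto
    then show ?thesis using assms(8) by simp
  qed
  have expand: "G r u = (\<Sum>i = 0..2 * n. T_basis n \<alpha> i u *\<^sub>R d r i)" if u: "u \<in> {0..\<alpha>}" for r u
  proof -
    have "G r u $ l = (\<Sum>i = 0..2 * n. T_basis n \<alpha> i u * d r i $ l)" for l
    proof -
      let ?\<psi> = "\<lambda>p. \<psi> l p + real r * pi / 2" and ?\<phi> = "\<lambda>q. \<phi> l q + real r * pi / 2"
      let ?A = "\<lambda>p i. mu n \<alpha> p i * cos (?\<psi> p) - lam n \<alpha> p i * sin (?\<psi> p)"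
      let ?B = "\<lambda>q i. lam n \<alpha> q i * cos (?\<phi> q) + mu n \<alpha> q i * sin (?\<phi> q)"
      have "G r u $ l =
          (\<Sum>p\<in>P l. c l p * real p ^ r * (\<Sum>i = 0..2 * n. ?A p i * T_basis n \<alpha> i u)) +
          (\<Sum>q\<in>Q l. s l q * real q ^ r * (\<Sum>i = 0..2 * n. ?B q i * T_basis n \<alpha> i u))"
        using assms(2,3) u bound[of _ l]
        by (simp add: G_def cos_shift_eq_sum[where n = n and \<alpha> = \<alpha>]
            sin_shift_eq_sum[where n = n and \<alpha> = \<alpha>])
      also have "\<dots> =
          (\<Sum>i = 0..2 * n. \<Sum>p\<in>P l. c l p * real p ^ r * (?A p i * T_basis n \<alpha> i u)) +
          (\<Sum>i = 0..2 * n. \<Sum>q\<in>Q l. s l q * real q ^ r * (?B q i * T_basis n \<alpha> i u))"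
        unfolding sum_distrib_left by (intro arg_cong2[where f = "(+)"] sum.swap)
      also have "\<dots> = (\<Sum>i = 0..2 * n. T_basis n \<alpha> i u * d r i $ l)"
        unfolding sum.distrib[symmetric]
      proof (intro sum.cong refl)
        fix i assume "i \<in> {0..2 * n}"
        then have "i \<le> 2 * n" by simp
        show "(\<Sum>p\<in>P l. c l p * real p ^ r * (?A p i * T_basis n \<alpha> i u)) +
            (\<Sum>q\<in>Q l. s l q * real q ^ r * (?B q i * T_basis n \<alpha> i u)) = T_basis n \<alpha> i u * d r i $ l"
          unfolding d[OF \<open>i \<le> 2 * n\<close>] distrib_left[of "T_basis n \<alpha> i u"] sum_distrib_left
          by (intro arg_cong2[where f = "(+)"] sum.cong refl) (simp_all only: mult_ac)
      qed
      finally show ?thesis .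
    qed
    then show ?thesis
      by (simp add: vec_eq_iff)
  qed
  have "nth_vector_derivative {0..\<alpha>} r g differentiable_on {0..\<alpha>}" for r
    unfolding differentiable_on_def
  proof
    fix u assume u: "u \<in> {0..\<alpha>}"
    have "(nth_vector_derivative {0..\<alpha>} r g has_vector_derivative G (Suc r) u) (at u within {0..\<alpha>})"
      using u nth deriv by (rule has_vector_derivative_transform)
    then show "nth_vector_derivative {0..\<alpha>} r g differentiable (at u within {0..\<alpha>})"
      by (rule differentiableI_vector)
  qed
  then show ?thesis
    using nth expand by simp
qed

end
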